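(* Let $G$ be a finite graph on vertex set $V$, and let $V = V_1 \sqcup V_2 \sqcup \dots \sqcup V_m$ be a partition of $V$. Suppose there are integers $q \ge 2$, $n \ge m+1$, and $k_1, \dots, k_m \ge 1$ with $|V_j| = qk_j - 1$ for all $j$ and $|V| = (q-1)n+1$. Suppose furthermore that for every continuous map $F\colon \mathrm{I}(G) \to \mathbb{R}^{n-1}$ there are $q$ pairwise disjoint faces $S_1, \dots, S_q$ of $\mathrm{I}(G)$ with $F(S_1) \cap \dots \cap F(S_q) \neq \emptyset$. Then $G$ admits a balanced almost fair splitting by $q$ independent sets.
   Context: A set of vertices is independent if it contains no two endpoints of an edge. The independence complex $\mathrm{I}(G)$ is the simplicial complex whose faces are the independent sets of $G$; it is regarded as a topological space via its geometric realization (the face $\sigma$ realized as the convex hull of the standard basis vectors $e_v$, $v \in \sigma$, in $\mathbb{R}^V$), and $F(S)$ denotes the image of the realized face $S$. Given a partition $V_1 \sqcup \dots \sqcup V_m$ of $V$, pairwise disjoint sets $S_1, \dots, S_q \subseteq V$ form an almost fair splitting if $|S_i \cap V_j| \ge \lfloor \frac{|V_j|+1}{q} \rfloor - 1$ for all $i,j$ and $|V_j \setminus \bigcup_i S_i| \le q-1$ for all $j$. The splitting is balanced if the cardinalities $|S_1|, \dots, |S_q|$ pairwise differ by at most one. *)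

theory Defs
  imports "HOL-Analysis.Analysis" "HOL-Library.Ramsey"
begin

text \<open>
  A finite graph is given by a finite vertex type and a set of edges, each edge being a two-element
  set of vertices; the vertex set is \<open>UNIV\<close>. Independence of a set is \<open>indep\<close> from Ramsey.
\<close>

definition independence_complex :: "'v set set \<Rightarrow> 'v set set" where
  "independence_complex E = {S. indep S E}"

definition realized_face :: "'v::finite set \<Rightarrow> (real ^ 'v) set" where
  "realized_face S = convex hull ((\<lambda>v. axis v 1) ` S)"

definition geometric_realization :: "'v::finite set set \<Rightarrow> (real ^ 'v) set" where
  "geometric_realization K = (\<Union>S\<in>K. realized_face S)"

definition almost_fair_splitting ::
  "nat \<Rightarrow> (nat \<Rightarrow> 'v set) \<Rightarrow> nat \<Rightarrow> (nat \<Rightarrow> 'v set) \<Rightarrow> bool" where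
  "almost_fair_splitting m V q S \<longleftrightarrow>
     disjoint_family_on S {1..q} \<and>
     (\<forall>i\<in>{1..q}. \<forall>j\<in>{1..m}.
        int (card (S i \<inter> V j)) \<ge> \<lfloor>(real (card (V j)) + 1) / real q\<rfloor> - 1) \<and>
     (\<forall>j\<in>{1..m}. int (card (V j - (\<Union>i\<in>{1..q}. S i))) \<le> int q - 1)"

definition balanced_splitting :: "nat \<Rightarrow> (nat \<Rightarrow> 'v set) \<Rightarrow> bool" where
  "balanced_splitting q S \<longleftrightarrow>
     (\<forall>i\<in>{1..q}. \<forall>i'\<in>{1..q}. \<bar>int (card (S i)) - int (card (S i'))\<bar> \<le> 1)"

end

theory Submission
  imports Defs
begin

text \<open>
  Send a point \<open>x\<close> of the independence complex to the elementary symmetric polynomials of degree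
  \<open>k j\<close> in its coordinates on \<open>V j\<close>, followed by the moments \<open>\<Sum>v. x v * t v ^ c\<close> with
  \<open>0 < c < n - m\<close>, and let \<open>T i\<close> be the supports of the preimages of a \<open>q\<close>-fold Tverberg point. Since
  \<open>card (V j) < q * k j\<close>, some \<open>T i\<close> has fewer than \<open>k j\<close> vertices in \<open>V j\<close>, so the \<open>j\<close>-th symmetric
  polynomial vanishes at one preimage, hence at all of them, and every \<open>T i\<close> has at most \<open>k j - 1\<close>
  vertices in \<open>V j\<close>. But if the points \<open>(1, t v, \<dots>, t v ^ (n - m - 1))\<close> of the moment curve
  are in strong general position, equal moments force the supports to have at least
  \<open>(q - 1) * (n - m) + 1\<close> vertices in total. This is exactly the sum of the upper bounds \<open>k j - 1\<close>, so
  all of them are attained. Strong general position is reached by choosing the points one at a time: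
  each has to avoid finitely many proper subspaces, and the curve meets each of these only finitely
  often.
\<close>

section \<open>Strong general position\<close>

lemma Int_span_insert_eq:
  fixes B X :: "'a::real_vector set"
  assumes B: "subspace B" and p: "p \<notin> span (B \<union> X)"
  shows "B \<inter> span (insert p X) = B \<inter> span X"
proof
  show "B \<inter> span (insert p X) \<subseteq> B \<inter> span X"
  proof
    fix x assume x: "x \<in> B \<inter> span (insert p X)"
    then obtain a where a: "x - a *\<^sub>R p \<in> span X"
      using span_breakdown_eq by blast
    have "a = 0"
    proof (rule ccontr)
      assume "a \<noteq> 0"
      have "x \<in> span (B \<union> X)" "x - a *\<^sub>R p \<in> span (B \<union> X)"
        using x a span_mono[of X "B \<union> X"] by (auto intro: span_base)
      then have "(1 / a) *\<^sub>R (x - (x - a *\<^sub>R p)) \<in> span (B \<union> X)"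
        by (rule span_scale[OF span_diff])
      with \<open>a \<noteq> 0\<close> p show False by simp
    qed
    with a x show "x \<in> B \<inter> span X" by simp
  qed
  show "B \<inter> span X \<subseteq> B \<inter> span (insert p X)"
    using span_mono[OF subset_insertI] by blast
qed

lemma dim_Int_span:
  fixes B X :: "'a::euclidean_space set"
  assumes "subspace B"
  shows "dim (B \<inter> span X) + dim (B \<union> X) = dim B + dim X"
proof -
  have "span (B \<union> X) = {x + y |x y. x \<in> B \<and> y \<in> span X}"
    using assms by (simp add: span_Un span_eq_iff[THEN iffD2])
  then have "dim (B \<union> X) = dim {x + y |x y. x \<in> B \<and> y \<in> span X}"
    using dim_span[of "B \<union> X"] by simp
  then show ?thesis
    using dim_sums_Int[OF assms subspace_span, of X] by simp
qed

definition Int_spans :: "'a::real_vector set \<Rightarrow> ('b \<Rightarrow> 'a) \<Rightarrow> 'b set set \<Rightarrow> 'a set" where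
  "Int_spans U p \<S> = U \<inter> (\<Inter>X\<in>\<S>. span (p ` X))"

lemma Int_spans_subset: "Int_spans U p \<S> \<subseteq> U"
  by (simp add: Int_spans_def)

lemma Int_spans_insert: "Int_spans U p (insert X \<S>) = Int_spans U p \<S> \<inter> span (p ` X)"
  by (auto simp: Int_spans_def)

lemma subspace_Int_spans: "subspace U \<Longrightarrow> subspace (Int_spans U p \<S>)"
  unfolding Int_spans_def by (intro subspace_Int subspace_inter subspace_Inter) auto

lemma Int_spans_cong:
  assumes "\<And>v. v \<in> \<Union>\<S> \<Longrightarrow> p v = p' v"
  shows "Int_spans U p \<S> = Int_spans U p' \<S>"
proof -
  have "p ` X = p' ` X" if "X \<in> \<S>" for X
    using assms that by (intro image_cong) auto
  then show ?thesis by (simp add: Int_spans_def)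
qed

text \<open>
  Without subtraction, the inequality says that the codimensions in \<open>U\<close> add up: the dimension is at most
  \<open>dim U - (\<Sum>X\<in>\<S>. dim U - card X)\<close>. The first disjunct covers the case that this bound is negative, and
  intersecting with \<open>U\<close> makes sense of \<open>\<S> = {}\<close>.
\<close>

definition meet_properly :: "'a::euclidean_space set \<Rightarrow> ('b \<Rightarrow> 'a) \<Rightarrow> 'b set set \<Rightarrow> bool" where
  "meet_properly U p \<S> \<longleftrightarrow> dim (Int_spans U p \<S>) = 0 \<or>
     dim (Int_spans U p \<S>) + card \<S> * dim U \<le> (\<Sum>X\<in>\<S>. card X) + dim U"

definition strong_general_position :: "'a::euclidean_space set \<Rightarrow> ('b \<Rightarrow> 'a) \<Rightarrow> 'b set \<Rightarrow> bool" where
  "strong_general_position U p A \<longleftrightarrow>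
     (\<forall>\<S>. finite \<S> \<longrightarrow> \<S> \<subseteq> Fpow A \<longrightarrow> disjoint \<S> \<longrightarrow> meet_properly U p \<S>)"

lemma strong_general_positionD:
  "strong_general_position U p A \<Longrightarrow> finite \<S> \<Longrightarrow> \<S> \<subseteq> Fpow A \<Longrightarrow> disjoint \<S> \<Longrightarrow> meet_properly U p \<S>"
  by (simp add: strong_general_position_def)

lemma strong_general_position_cong:
  assumes "\<And>v. v \<in> A \<Longrightarrow> p v = p' v"
  shows "strong_general_position U p A \<longleftrightarrow> strong_general_position U p' A"
proof -
  have "Int_spans U p \<S> = Int_spans U p' \<S>" if "\<S> \<subseteq> Fpow A" for \<S>
    using assms that by (intro Int_spans_cong) (auto simp: Fpow_def)
  then show ?thesis
    by (simp add: strong_general_position_def meet_properly_def cong: imp_cong)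
qed

lemma meet_properly_if_empty_mem: "{} \<in> \<S> \<Longrightarrow> meet_properly U p \<S>"
  by (auto simp: meet_properly_def Int_spans_def)

lemma strong_general_position_empty: "strong_general_position U p {}"
  unfolding strong_general_position_def
proof (intro allI impI)
  fix \<S> :: "'b set set" assume "\<S> \<subseteq> Fpow {}"
  then consider "\<S> = {}" | "{} \<in> \<S>"
    by (auto simp: Fpow_def)
  then show "meet_properly U p \<S>"
    by cases (simp_all add: meet_properly_if_empty_mem, simp add: meet_properly_def Int_spans_def)
qed

lemma meet_properly_insert_point:
  assumes U: "subspace U"
    and \<S>: "finite \<S>" "insert v T \<notin> \<S>" "meet_properly U p \<S>"
    and T: "finite T" "v \<notin> T" "T \<noteq> {} \<Longrightarrow> T \<notin> \<S>" "meet_properly U p (insert T \<S>)"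
    and generic: "p v \<in> span (Int_spans U p \<S> \<union> p ` T) \<Longrightarrow> span (Int_spans U p \<S> \<union> p ` T) = U"
  shows "meet_properly U p (insert (insert v T) \<S>)"
proof (cases "p v \<in> span (Int_spans U p \<S> \<union> p ` T)")
  case False
  then have same: "Int_spans U p (insert (insert v T) \<S>) = Int_spans U p (insert T \<S>)"
    using Int_span_insert_eq[OF subspace_Int_spans[OF U]] by (simp add: Int_spans_insert)
  show ?thesis
  proof (cases "T = {}")
    case True
    then have "dim (Int_spans U p (insert T \<S>)) = 0"
      by (auto simp: Int_spans_insert)
    then show ?thesis by (simp add: meet_properly_def same)
  next
    case False
    then show ?thesis using \<S> T by (auto simp: meet_properly_def same)
  qed
next
  case True
  let ?B = "Int_spans U p \<S>" and ?X = "insert (p v) (p ` T)"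
  have "span (?B \<union> ?X) = U"
    using generic[OF True] True by (simp add: span_redundant)
  then have "dim (?B \<inter> span ?X) + dim U = dim ?B + dim ?X"
    using dim_Int_span[OF subspace_Int_spans[OF U], of p \<S> ?X] by (metis dim_span)
  moreover have "dim ?X \<le> Suc (card T)"
    using dim_le_card'[of ?X] card_image_le[of "insert v T" p] T by simp
  moreover have "dim (?B \<inter> span ?X) \<le> dim ?B"
    by (intro dim_subset) auto
  ultimately show ?thesis
    using \<S> T(1,2) by (auto simp: meet_properly_def Int_spans_insert)
qed

lemma strong_general_position_insert:
  assumes U: "subspace U" and A: "strong_general_position U p A"
    and generic: "\<And>\<S> X. \<S> \<subseteq> Fpow A \<Longrightarrow> X \<in> Fpow A \<Longrightarrow>
      p v \<in> span (Int_spans U p \<S> \<union> p ` X) \<Longrightarrow> span (Int_spans U p \<S> \<union> p ` X) = U"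
  shows "strong_general_position U p (insert v A)"
  unfolding strong_general_position_def
proof (intro allI impI)
  fix \<S> assume \<S>: "finite \<S>" "\<S> \<subseteq> Fpow (insert v A)" "disjoint \<S>"
  show "meet_properly U p \<S>"
  proof (cases "v \<in> \<Union>\<S>")
    case False
    then have "\<S> \<subseteq> Fpow A"
      using \<S>(2) unfolding Fpow_def by blast
    with A \<S> show ?thesis by (simp add: strong_general_positionD)
  next
    case True
    then obtain X where X: "X \<in> \<S>" "v \<in> X" by blast
    define T where "T = X - {v}"
    define \<J> where "\<J> = \<S> - {X}"
    have \<S>_eq: "\<S> = insert (insert v T) \<J>" and notin: "insert v T \<notin> \<J>" "v \<notin> T"
      using X by (auto simp: T_def \<J>_def insert_absorb)
    have disjoint_X: "Y \<inter> X = {}" if "Y \<in> \<J>" for Y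
      using that \<S>(3) X unfolding \<J>_def by (auto dest: disjointD)
    have "v \<notin> Y" if "Y \<in> \<J>" for Y
      using disjoint_X[OF that] X(2) by blast
    then have "\<J> \<subseteq> Fpow A"
      using \<S>(2) unfolding \<J>_def Fpow_def by blast
    then have \<J>: "finite \<J>" "\<J> \<subseteq> Fpow A" "disjoint \<J>"
      using \<S> by (auto simp: \<J>_def disjoint_def)
    have disjoint_T: "Y \<inter> T = {}" if "Y \<in> \<J>" for Y
      using disjoint_X[OF that] by (auto simp: T_def)
    have T: "T \<in> Fpow A" "T \<noteq> {} \<Longrightarrow> T \<notin> \<J>"
      using \<S>(2) X disjoint_T by (auto simp: T_def Fpow_def)
    have "disjoint (insert T \<J>)"
      using \<J>(3) disjoint_T unfolding disjoint_def by blast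
    show ?thesis
      unfolding \<S>_eq
    proof (rule meet_properly_insert_point)
      show "meet_properly U p \<J>" "meet_properly U p (insert T \<J>)"
        using \<J> T \<open>disjoint (insert T \<J>)\<close> by (auto intro!: strong_general_positionD[OF A])
    qed (use U \<J> T notin generic in \<open>auto simp: Fpow_def\<close>)
  qed
qed

lemma exists_point_spanning_if_dependent:
  assumes "finite A" and U: "subspace U" and p: "p ` A \<subseteq> U"
    and not_covered: "\<And>\<W>. finite \<W> \<Longrightarrow> (\<And>W. W \<in> \<W> \<Longrightarrow> subspace W \<and> W \<subset> U) \<Longrightarrow> \<not> \<Gamma> \<subseteq> \<Union>\<W>"
  obtains w where "w \<in> \<Gamma>"
    and "\<And>\<S> X. \<S> \<subseteq> Pow A \<Longrightarrow> X \<subseteq> A \<Longrightarrow> w \<in> span (Int_spans U p \<S> \<union> p ` X) \<Longrightarrow>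
      span (Int_spans U p \<S> \<union> p ` X) = U"
proof -
  define spans where "spans \<S> X = span (Int_spans U p \<S> \<union> p ` X)" for \<S> X
  define \<W> where "\<W> = {spans \<S> X |\<S> X. \<S> \<subseteq> Pow A \<and> X \<subseteq> A} - {U}"
  have "\<W> \<subseteq> (\<lambda>(\<S>, X). spans \<S> X) ` (Pow (Pow A) \<times> Pow A)"
    by (auto simp: \<W>_def)
  then have "finite \<W>"
    using \<open>finite A\<close> by (auto intro: finite_subset)
  moreover have "spans \<S> X \<subseteq> U" if "X \<subseteq> A" for \<S> X
    unfolding spans_def using that p Int_spans_subset[of U] by (intro span_minimal[OF _ U]) blast
  then have "subspace W \<and> W \<subset> U" if "W \<in> \<W>" for W
    using that by (auto simp: \<W>_def spans_def)
  ultimately obtain w where w: "w \<in> \<Gamma>" "w \<notin> \<Union>\<W>"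
    using not_covered[of \<W>] by blast
  have "spans \<S> X = U" if "\<S> \<subseteq> Pow A" "X \<subseteq> A" "w \<in> spans \<S> X" for \<S> X
  proof (rule ccontr)
    assume "spans \<S> X \<noteq> U"
    then have "spans \<S> X \<in> \<W>"
      using that(1,2) unfolding \<W>_def by blast
    with w(2) that(3) show False by blast
  qed
  with w(1) show ?thesis
    unfolding spans_def by (rule that)
qed

lemma exists_strong_general_position:
  assumes "finite A" and U: "subspace U" and \<Gamma>: "\<Gamma> \<subseteq> U"
    and not_covered: "\<And>\<W>. finite \<W> \<Longrightarrow> (\<And>W. W \<in> \<W> \<Longrightarrow> subspace W \<and> W \<subset> U) \<Longrightarrow> \<not> \<Gamma> \<subseteq> \<Union>\<W>"
  shows "\<exists>p. p ` A \<subseteq> \<Gamma> \<and> strong_general_position U p A"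
  using \<open>finite A\<close>
proof (induction A rule: finite_induct)
  case empty
  show ?case by (simp add: strong_general_position_empty)
next
  case (insert v A)
  then obtain p where p: "p ` A \<subseteq> \<Gamma>" "strong_general_position U p A" by blast
  have "p ` A \<subseteq> U"
    using p(1) \<Gamma> by blast
  then obtain w where w: "w \<in> \<Gamma>"
    and generic: "\<And>\<S> X. \<S> \<subseteq> Pow A \<Longrightarrow> X \<subseteq> A \<Longrightarrow> w \<in> span (Int_spans U p \<S> \<union> p ` X) \<Longrightarrow>
      span (Int_spans U p \<S> \<union> p ` X) = U"
    using exists_point_spanning_if_dependent[OF insert.hyps(1) U _ not_covered] by metis
  define p' where "p' = p(v := w)"
  have p': "p' u = p u" if "u \<in> A" for u
    using that insert.hyps by (auto simp: p'_def)
  have "strong_general_position U p' (insert v A)"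
  proof (rule strong_general_position_insert[OF U])
    show "strong_general_position U p' A"
      using p(2) strong_general_position_cong[of A p' p U, OF p'] by simp
    fix \<S> X assume \<S>: "\<S> \<subseteq> Fpow A" and X: "X \<in> Fpow A"
      and mem: "p' v \<in> span (Int_spans U p' \<S> \<union> p' ` X)"
    have "Int_spans U p' \<S> = Int_spans U p \<S>"
      using \<S> p' by (intro Int_spans_cong) (auto simp: Fpow_def)
    moreover have "p' ` X = p ` X"
      using X p' by (intro image_cong) (auto simp: Fpow_def)
    moreover have "\<S> \<subseteq> Pow A" "X \<subseteq> A"
      using \<S> X by (auto simp: Fpow_def)
    ultimately show "span (Int_spans U p' \<S> \<union> p' ` X) = U"
      using mem generic by (simp add: p'_def)
  qed
  moreover have "p' ` insert v A \<subseteq> \<Gamma>"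
    using p(1) p' w by (auto simp: p'_def)
  ultimately show ?case by blast
qed

lemma strong_general_position_card_ge:
  assumes sgp: "strong_general_position U p A"
    and I: "finite I" "I \<noteq> {}"
    and S: "\<And>i. i \<in> I \<Longrightarrow> S i \<in> Fpow A" "disjoint_family_on S I"
    and z: "z \<in> U" "z \<noteq> 0" "\<And>i. i \<in> I \<Longrightarrow> z \<in> span (p ` S i)"
  shows "(card I - 1) * dim U + 1 \<le> (\<Sum>i\<in>I. card (S i))"
proof -
  have "S i \<noteq> {}" if "i \<in> I" for i
    using z(2) z(3)[OF that] by auto
  then have S': "disjoint (S ` I)" "inj_on S I"
    using S(2) by (simp_all add: disjoint_family_on_iff_disjoint_image)
  have "z \<in> Int_spans U p (S ` I)"
    using z by (simp add: Int_spans_def)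
  then have "dim (Int_spans U p (S ` I)) \<ge> 1"
    using z(2) dim_eq_0[of "Int_spans U p (S ` I)"] by fastforce
  moreover have "meet_properly U p (S ` I)"
    using I(1) S S' by (intro strong_general_positionD[OF sgp]) auto
  ultimately have "1 + card I * dim U \<le> (\<Sum>i\<in>I. card (S i)) + dim U"
    using S' by (auto simp: meet_properly_def card_image sum.reindex simp del: dim_eq_0)
  moreover have "card I = Suc (card I - 1)"
    using I by (simp add: card_gt_0_iff)
  then have "card I * dim U = (card I - 1) * dim U + dim U"
    by (metis add.commute mult_Suc)
  ultimately show ?thesis by linarith
qed

section \<open>Supports of points of the realization\<close>

definition vec_support :: "'a::zero ^ 'v \<Rightarrow> 'v set" where
  "vec_support x = {v. x $ v \<noteq> 0}"

lemma realized_face_eq: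
  "realized_face S = {x. (\<forall>v. 0 \<le> x $ v) \<and> (\<Sum>v\<in>UNIV. x $ v) = 1 \<and> vec_support x \<subseteq> S}" (is "_ = ?C")
proof
  have "convex ?C"
    by (auto simp: convex_def vec_support_def sum.distrib simp flip: sum_distrib_left) force
  moreover have "(\<lambda>v. axis v 1) ` S \<subseteq> ?C"
    by (auto simp: axis_def vec_support_def split: if_splits)
  ultimately show "realized_face S \<subseteq> ?C"
    unfolding realized_face_def by (rule hull_minimal[rotated])
  show "?C \<subseteq> realized_face S"
  proof
    fix x assume x: "x \<in> ?C"
    have outside: "x $ v = 0" if "v \<notin> S" for v
      using x that by (auto simp: vec_support_def)
    have "(\<Sum>v\<in>S. x $ v *\<^sub>R axis v (1::real)) = (\<Sum>v\<in>UNIV. x $ v *\<^sub>R axis v 1)"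
      by (rule sum.mono_neutral_left) (auto simp: outside)
    also have "\<dots> = x"
      using basis_expansion[of x] by (simp add: scalar_mult_eq_scaleR)
    finally have "x = (\<Sum>v\<in>S. x $ v *\<^sub>R axis v 1)" ..
    also have "\<dots> \<in> realized_face S"
    proof -
      have "(\<Sum>v\<in>S. x $ v) = (\<Sum>v\<in>UNIV. x $ v)"
        by (rule sum.mono_neutral_left) (auto simp: outside)
      with x show ?thesis
        unfolding realized_face_def by (intro convex_sum) (auto intro: hull_inc)
    qed
    finally show "x \<in> realized_face S" .
  qed
qed

section \<open>Moment curves\<close>

definition moment_curve :: "(nat \<Rightarrow> 'a::real_vector) \<Rightarrow> nat \<Rightarrow> real \<Rightarrow> 'a" where
  "moment_curve e D t = (\<Sum>c<D. t ^ c *\<^sub>R e c)"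

lemma moment_curve_in_span: "moment_curve e D t \<in> span (e ` {..<D})"
  unfolding moment_curve_def by (intro span_sum span_scale span_base) auto

lemma sum_scaleR_moment_curve:
  "(\<Sum>v\<in>A. x v *\<^sub>R moment_curve e D (t v)) = (\<Sum>c<D. (\<Sum>v\<in>A. x v * t v ^ c) *\<^sub>R e c)"
  unfolding moment_curve_def scaleR_sum_right scaleR_sum_left by (subst sum.swap) simp

lemma finite_moment_curve_in_subspace:
  fixes e :: "nat \<Rightarrow> 'a::euclidean_space"
  assumes W: "subspace W" "W \<subset> span (e ` {..<D})"
  shows "finite {t. moment_curve e D t \<in> W}"
proof -
  have "span W \<subset> span (e ` {..<D})"
    using W by (simp add: span_eq_iff[THEN iffD2])
  then obtain a where a: "a \<noteq> 0" "a \<in> span (e ` {..<D})" "\<And>y. y \<in> span W \<Longrightarrow> orthogonal a y"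
    using orthogonal_to_subspace_exists_gen by metis
  have "\<exists>c<D. a \<bullet> e c \<noteq> 0"
  proof (rule ccontr)
    assume "\<not> ?thesis"
    then have "orthogonal a y" if "y \<in> e ` {..<D}" for y
      using that by (auto simp: orthogonal_def)
    then have "orthogonal a a"
      using a(2) orthogonal_to_span by blast
    with a(1) show False by (simp add: orthogonal_def)
  qed
  then obtain c where c: "c < D" "a \<bullet> e c \<noteq> 0" by blast
  then have "finite {t. (\<Sum>i\<le>D - 1. (a \<bullet> e i) * t ^ i) = 0}"
    by (subst polyfun_finite_roots) (auto intro!: exI[of _ c])
  moreover have "(\<Sum>i\<le>D - 1. (a \<bullet> e i) * t ^ i) = 0" if "moment_curve e D t \<in> W" for t
  proof -
    have "a \<bullet> moment_curve e D t = 0"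
      using a(3)[OF span_base[OF that]] by (simp add: orthogonal_def)
    moreover have "{..D - 1} = {..<D}"
      using c(1) by auto
    ultimately show ?thesis
      by (simp add: moment_curve_def inner_sum_right mult.commute)
  qed
  ultimately show ?thesis
    by (auto elim: finite_subset[rotated])
qed

lemma exists_strong_general_position_moment_curve:
  fixes e :: "nat \<Rightarrow> 'a::euclidean_space"
  assumes "finite A"
  shows "\<exists>t. strong_general_position (span (e ` {..<D})) (\<lambda>v. moment_curve e D (t v)) A"
proof -
  let ?U = "span (e ` {..<D})" and ?\<Gamma> = "range (moment_curve e D)"
  have "\<not> ?\<Gamma> \<subseteq> \<Union>\<W>"
    if "finite \<W>" and \<W>: "\<And>W. W \<in> \<W> \<Longrightarrow> subspace W \<and> W \<subset> ?U" for \<W>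
  proof
    assume "?\<Gamma> \<subseteq> \<Union>\<W>"
    then have "(\<Union>W\<in>\<W>. {t. moment_curve e D t \<in> W}) = UNIV" by blast
    moreover have "finite (\<Union>W\<in>\<W>. {t. moment_curve e D t \<in> W})"
      using \<open>finite \<W>\<close> \<W> by (simp add: finite_moment_curve_in_subspace)
    ultimately show False by (simp add: infinite_UNIV_char_0)
  qed
  then obtain p where p: "p ` A \<subseteq> ?\<Gamma>" "strong_general_position ?U p A"
    using exists_strong_general_position[of A ?U ?\<Gamma>] assms moment_curve_in_span by blast
  define t where "t v = inv (moment_curve e D) (p v)" for v
  have "p v = moment_curve e D (t v)" if "v \<in> A" for v
    unfolding t_def using p(1) that by (intro f_inv_into_f[symmetric]) auto
  then have "strong_general_position ?U (\<lambda>v. moment_curve e D (t v)) A"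
    using p(2) strong_general_position_cong[of A p "\<lambda>v. moment_curve e D (t v)" ?U] by simp
  then show ?thesis by blast
qed

definition moment :: "('v \<Rightarrow> real) \<Rightarrow> nat \<Rightarrow> real ^ 'v \<Rightarrow> real" where
  "moment t c x = (\<Sum>v\<in>UNIV. x $ v * t v ^ c)"

lemma moment_0: "moment t 0 x = (\<Sum>v\<in>UNIV. x $ v)"
  by (simp add: moment_def)

lemma sum_scaleR_in_span_vec_support:
  fixes x :: "real ^ 'v::finite"
  shows "(\<Sum>v\<in>UNIV. x $ v *\<^sub>R p v) \<in> span (p ` vec_support x)"
proof (rule span_sum)
  fix v show "x $ v *\<^sub>R p v \<in> span (p ` vec_support x)"
    by (cases "x $ v = 0") (auto simp: vec_support_def intro: span_scale span_base span_zero)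
qed

lemma exists_generic_moment_curve:
  assumes "D \<le> CARD('v::finite)"
  obtains e :: "nat \<Rightarrow> real ^ 'v::finite" and t :: "'v \<Rightarrow> real"
  where "inj_on e {..<D}" "e ` {..<D} \<subseteq> Basis"
    and "strong_general_position (span (e ` {..<D})) (\<lambda>v. moment_curve e D (t v)) UNIV"
proof -
  obtain e :: "nat \<Rightarrow> real ^ 'v" where e: "inj_on e {..<D}" "e ` {..<D} \<subseteq> Basis"
    using assms card_le_inj[of "{..<D}" "Basis :: (real ^ 'v) set"] by auto
  obtain t :: "'v \<Rightarrow> real"
    where "strong_general_position (span (e ` {..<D})) (\<lambda>v. moment_curve e D (t v)) UNIV"
    using exists_strong_general_position_moment_curve[OF finite_class.finite_UNIV] by blast
  with e show ?thesis by (rule that)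
qed

lemma sum_card_vec_support_ge:
  fixes e :: "nat \<Rightarrow> 'a::euclidean_space" and x :: "'i \<Rightarrow> real ^ 'v::finite"
  assumes e: "inj_on e {..<D}" "e ` {..<D} \<subseteq> Basis"
    and t: "strong_general_position (span (e ` {..<D})) (\<lambda>v. moment_curve e D (t v)) UNIV"
    and I: "finite I" "I \<noteq> {}"
    and disj: "disjoint_family_on (\<lambda>i. vec_support (x i)) I"
    and moments: "\<And>i c. i \<in> I \<Longrightarrow> c < D \<Longrightarrow> moment t c (x i) = \<mu> c"
    and \<mu>: "c < D" "\<mu> c \<noteq> 0"
  shows "(card I - 1) * D + 1 \<le> (\<Sum>i\<in>I. card (vec_support (x i)))"
proof -
  let ?U = "span (e ` {..<D})" and ?p = "\<lambda>v. moment_curve e D (t v)"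
  have dim_U: "dim ?U = D"
    using independent_mono[OF independent_Basis e(2)] card_image[OF e(1)]
    by (simp add: dim_eq_card_independent)
  define z where "z = (\<Sum>c<D. \<mu> c *\<^sub>R e c)"
  have z: "z = (\<Sum>v\<in>UNIV. x i $ v *\<^sub>R ?p v)" if "i \<in> I" for i
    using moments[OF that] by (simp add: z_def sum_scaleR_moment_curve moment_def)
  have "e d \<bullet> e c = (if d = c then 1 else 0)" if "d < D" for d
    using that e \<mu>(1) inj_onD[OF e(1), of d c] by (auto simp: inner_Basis image_subset_iff)
  then have "z \<bullet> e c = (\<Sum>d<D. if d = c then \<mu> d else 0)"
    unfolding z_def inner_sum_left by (intro sum.cong) auto
  then have "z \<noteq> 0"
    using \<mu> by auto
  moreover have "z \<in> ?U"
    unfolding z_def by (intro span_sum span_scale span_base) auto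
  moreover have "z \<in> span (?p ` vec_support (x i))" if "i \<in> I" for i
    unfolding z[OF that] by (rule sum_scaleR_in_span_vec_support)
  ultimately show ?thesis
    using strong_general_position_card_ge[OF t I _ disj] unfolding dim_U by (simp add: Fpow_def)
qed

section \<open>Elementary symmetric polynomials on disjoint supports\<close>

definition elem_sym :: "'b set \<Rightarrow> nat \<Rightarrow> ('b \<Rightarrow> 'a::comm_semiring_1) \<Rightarrow> 'a" where
  "elem_sym X k x = (\<Sum>T | T \<subseteq> X \<and> card T = k. \<Prod>v\<in>T. x v)"

lemma elem_sym_eq_0_iff:
  fixes x :: "'b \<Rightarrow> 'a::linordered_semidom"
  assumes X: "finite X" and x: "\<And>v. v \<in> X \<Longrightarrow> 0 \<le> x v"
  shows "elem_sym X k x = 0 \<longleftrightarrow> card {v \<in> X. x v \<noteq> 0} < k"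
proof -
  define Y where "Y = {v \<in> X. x v \<noteq> 0}"
  have "elem_sym X k x = 0 \<longleftrightarrow> (\<forall>T\<in>{T. T \<subseteq> X \<and> card T = k}. (\<Prod>v\<in>T. x v) = 0)"
    unfolding elem_sym_def
  proof (rule sum_nonneg_eq_0_iff)
    show "finite {T. T \<subseteq> X \<and> card T = k}"
      using X by simp
    show "0 \<le> (\<Prod>v\<in>T. x v)" if "T \<in> {T. T \<subseteq> X \<and> card T = k}" for T
      using that x by (intro prod_nonneg) auto
  qed
  also have "\<dots> \<longleftrightarrow> (\<forall>T\<in>{T. T \<subseteq> X \<and> card T = k}. \<not> T \<subseteq> Y)"
  proof (intro ball_cong refl)
    fix T assume "T \<in> {T. T \<subseteq> X \<and> card T = k}"
    then show "(\<Prod>v\<in>T. x v) = 0 \<longleftrightarrow> \<not> T \<subseteq> Y"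
      using finite_subset[OF _ X, of T] by (auto simp: Y_def prod_zero_iff)
  qed
  also have "\<dots> \<longleftrightarrow> \<not> (\<exists>T\<subseteq>Y. card T = k)"
    by (auto simp: Y_def)
  also have "\<dots> \<longleftrightarrow> card Y < k"
  proof -
    have "finite Y"
      using X by (simp add: Y_def)
    then have "(\<exists>T\<subseteq>Y. card T = k) \<longleftrightarrow> k \<le> card Y"
      by (meson card_mono obtain_subset_with_card_n)
    then show ?thesis by (simp only: not_le)
  qed
  finally show ?thesis unfolding Y_def .
qed

lemma card_UN_Int_disjoint:
  assumes "disjoint_family_on S I" "finite I" "finite X"
  shows "card (\<Union>i\<in>I. S i \<inter> X) = (\<Sum>i\<in>I. card (S i \<inter> X))"
  using assms by (intro card_UN_disjoint') (auto simp: disjoint_family_on_def)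

lemma exists_card_Int_less:
  assumes "finite I" "finite X" "disjoint_family_on S I" "card X < card I * k"
  shows "\<exists>i\<in>I. card (S i \<inter> X) < k"
proof (rule ccontr)
  assume "\<not> ?thesis"
  then have "(\<Sum>i\<in>I. k) \<le> (\<Sum>i\<in>I. card (S i \<inter> X))"
    by (intro sum_mono) (auto simp: not_less)
  also have "\<dots> = card (\<Union>i\<in>I. S i \<inter> X)"
    by (rule card_UN_Int_disjoint[OF assms(3,1,2), symmetric])
  also have "\<dots> \<le> card X"
    using assms(2) by (intro card_mono) auto
  finally show False using assms(4) by simp
qed

lemma card_vec_support_Int_less:
  fixes x :: "'i \<Rightarrow> real ^ 'v::finite"
  assumes "finite I" "disjoint_family_on (\<lambda>i. vec_support (x i)) I" "card X < card I * k"
    and nonneg: "\<And>i v. i \<in> I \<Longrightarrow> 0 \<le> x i $ v"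
    and elem_sym_eq: "\<And>i. i \<in> I \<Longrightarrow> elem_sym X k (($) (x i)) = a"
    and i: "i \<in> I"
  shows "card (vec_support (x i) \<inter> X) < k"
proof -
  have vanish_iff: "elem_sym X k (($) (x i)) = 0 \<longleftrightarrow> card (vec_support (x i) \<inter> X) < k" if "i \<in> I" for i
  proof -
    have "vec_support (x i) \<inter> X = {v \<in> X. x i $ v \<noteq> 0}"
      by (auto simp: vec_support_def)
    then show ?thesis
      using nonneg[OF that] by (simp add: elem_sym_eq_0_iff)
  qed
  obtain i' where "i' \<in> I" "card (vec_support (x i') \<inter> X) < k"
    using exists_card_Int_less[of I X "\<lambda>i. vec_support (x i)" k] assms(1-3) by auto
  with vanish_iff elem_sym_eq i show ?thesis by metis
qed

section \<open>The test map\<close>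

text \<open>
  The coordinates \<open>m, m + 1, \<dots>\<close> are the moments of degree \<open>1, 2, \<dots>\<close>; degree \<open>0\<close> is omitted because that
  moment is constantly \<open>1\<close> on every face.
\<close>

definition test_map ::
  "nat \<Rightarrow> nat \<Rightarrow> (nat \<Rightarrow> 'v set) \<Rightarrow> (nat \<Rightarrow> nat) \<Rightarrow> ('v \<Rightarrow> real) \<Rightarrow> real ^ 'v \<Rightarrow> nat \<Rightarrow> real" where
  "test_map m N V k t x i =
     (if i < m then elem_sym (V (Suc i)) (k (Suc i)) (($) x)
      else if i < N then moment t (Suc i - m) x
      else 0)"

lemma continuous_map_test_map:
  assumes "m \<le> N"
  shows "continuous_map (top_of_set X) (Euclidean_space N) (test_map m N V k t)"
proof -
  have "continuous_on X (\<lambda>x. test_map m N V k t x i)" for i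
    unfolding test_map_def elem_sym_def moment_def
    by (cases "i < m"; cases "i < N") (auto intro!: continuous_intros)
  moreover have "test_map m N V k t = (\<lambda>x i. if i < N then test_map m N V k t x i else 0)"
    using assms by (auto simp: test_map_def fun_eq_iff)
  ultimately show ?thesis
    by (subst \<open>test_map m N V k t = _\<close>, subst continuous_map_componentwise_Euclidean_space) simp
qed

lemma test_map_elem_sym:
  assumes "j \<in> {1..m}"
  shows "test_map m N V k t x (j - 1) = elem_sym (V j) (k j) (($) x)"
  using assms by (auto simp: test_map_def)

lemma test_map_moment:
  assumes "c < N - m"
  shows "test_map m N V k t x (m + c) = moment t (Suc c) x"
  using assms by (simp add: test_map_def Suc_diff_le)

section \<open>Partitions into parts of size one less than a multiple of q\<close>

locale near_multiple_partition =
  fixes V :: "nat \<Rightarrow> 'v::finite set" and k :: "nat \<Rightarrow> nat" and m n q :: nat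
  assumes disjoint_parts: "disjoint_family_on V {1..m}"
    and Union_parts: "(\<Union>j\<in>{1..m}. V j) = UNIV"
    and q_ge_2: "q \<ge> 2"
    and m_less_n: "m < n"
    and k_ge_1: "j \<in> {1..m} \<Longrightarrow> k j \<ge> 1"
    and card_part: "j \<in> {1..m} \<Longrightarrow> card (V j) = q * k j - 1"
    and card_vertices: "CARD('v) = (q - 1) * n + 1"
begin

lemma Suc_card_part: "j \<in> {1..m} \<Longrightarrow> Suc (card (V j)) = q * k j"
  using card_part[of j] k_ge_1[of j] q_ge_2 by simp

lemma card_part_decomp: "j \<in> {1..m} \<Longrightarrow> card (V j) = q * (k j - 1) + (q - 1)"
  using Suc_card_part[of j] k_ge_1[of j] q_ge_2 by (cases "k j") auto

lemma card_eq_sum_card_Int_parts: "card X = (\<Sum>j\<in>{1..m}. card (X \<inter> V j))"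
proof -
  have "card (\<Union>j\<in>{1..m}. X \<inter> V j) = (\<Sum>j\<in>{1..m}. card (X \<inter> V j))"
    using card_UN_Int_disjoint[OF disjoint_parts _ finite[of X]] by (simp only: Int_commute finite_atLeastAtMost)
  moreover have "(\<Union>j\<in>{1..m}. X \<inter> V j) = X"
    using Union_parts by blast
  ultimately show ?thesis by simp
qed

lemma mult_sum_pred_k: "q * (\<Sum>j\<in>{1..m}. k j - 1) = (q - 1) * (n - m) + 1"
proof -
  have "(\<Sum>j\<in>{1..m}. card (V j)) = q * (\<Sum>j\<in>{1..m}. k j - 1) + m * (q - 1)"
    by (simp add: card_part_decomp sum.distrib sum_distrib_left cong: sum.cong_simp)
  moreover have "(\<Sum>j\<in>{1..m}. card (V j)) = (q - 1) * n + 1"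
    using card_eq_sum_card_Int_parts[of UNIV] card_vertices by simp
  moreover have "n = (n - m) + m"
    using m_less_n by simp
  then have "(q - 1) * n = (q - 1) * (n - m) + m * (q - 1)"
    by (metis distrib_left mult.commute)
  ultimately show ?thesis by linarith
qed

lemma card_Int_part_eq:
  assumes upper: "\<And>i j. i \<in> {1..q} \<Longrightarrow> j \<in> {1..m} \<Longrightarrow> card (S i \<inter> V j) < k j"
    and lower: "(q - 1) * (n - m) + 1 \<le> (\<Sum>i\<in>{1..q}. card (S i))"
    and "i \<in> {1..q}" "j \<in> {1..m}"
  shows "card (S i \<inter> V j) = k j - 1"
proof -
  let ?P = "{1..q} \<times> {1..m}"
  have le: "(case p of (i, j) \<Rightarrow> card (S i \<inter> V j)) \<le> (case p of (i, j) \<Rightarrow> k j - 1)" if "p \<in> ?P" for p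
    using that upper by fastforce
  have "(\<Sum>(i, j)\<in>?P. k j - 1) = (q - 1) * (n - m) + 1"
    using mult_sum_pred_k by (simp flip: sum.cartesian_product)
  also have "\<dots> \<le> (\<Sum>i\<in>{1..q}. card (S i))"
    by (rule lower)
  also have "\<dots> = (\<Sum>(i, j)\<in>?P. card (S i \<inter> V j))"
    by (subst card_eq_sum_card_Int_parts) (simp add: sum.cartesian_product)
  finally have total_eq: "(\<Sum>(i, j)\<in>?P. card (S i \<inter> V j)) = (\<Sum>(i, j)\<in>?P. k j - 1)"
    using le by (intro antisym[OF sum_mono])
  then show ?thesis
    using sum_mono_inv[OF total_eq le, of "(i, j)"] assms(3,4) by simp
qed

lemma almost_fair_splitting_if_card_Int_eq:
  assumes disj: "disjoint_family_on S {1..q}"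
    and card_Int: "\<And>i j. i \<in> {1..q} \<Longrightarrow> j \<in> {1..m} \<Longrightarrow> card (S i \<inter> V j) = k j - 1"
  shows "almost_fair_splitting m V q S"
  unfolding almost_fair_splitting_def
proof (intro conjI ballI disj)
  fix j assume j: "j \<in> {1..m}"
  have "real (card (V j)) + 1 = real q * real (k j)"
    using arg_cong[OF Suc_card_part[OF j], of real] by simp
  then have floor: "\<lfloor>(real (card (V j)) + 1) / real q\<rfloor> = int (k j)"
    using q_ge_2 by simp
  show "int (card (S i \<inter> V j)) \<ge> \<lfloor>(real (card (V j)) + 1) / real q\<rfloor> - 1" if "i \<in> {1..q}" for i
    using card_Int[OF that j] k_ge_1[OF j] by (simp add: floor of_nat_diff)
  have "card (\<Union>i\<in>{1..q}. S i \<inter> V j) = q * (k j - 1)"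
    using card_Int[OF _ j] by (subst card_UN_Int_disjoint[OF disj]) auto
  moreover have "card (V j - (\<Union>i\<in>{1..q}. S i)) = card (V j) - card (\<Union>i\<in>{1..q}. S i \<inter> V j)"
    by (subst card_Diff_subset[symmetric]) (auto intro: arg_cong[where f = card])
  ultimately have "card (V j - (\<Union>i\<in>{1..q}. S i)) = q - 1"
    using card_part_decomp[OF j] by simp
  then show "int (card (V j - (\<Union>i\<in>{1..q}. S i))) \<le> int q - 1"
    using q_ge_2 by simp
qed

lemma balanced_splitting_if_card_Int_eq:
  assumes "\<And>i j. i \<in> {1..q} \<Longrightarrow> j \<in> {1..m} \<Longrightarrow> card (S i \<inter> V j) = k j - 1"
  shows "balanced_splitting q S"
proof -
  have "card (S i) = (\<Sum>j\<in>{1..m}. k j - 1)" if "i \<in> {1..q}" for i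
    using assms that by (subst card_eq_sum_card_Int_parts) simp
  then show ?thesis by (simp add: balanced_splitting_def)
qed

lemma splitting_vec_support_if_test_map_eq:
  assumes y: "\<And>i. i \<in> {1..q} \<Longrightarrow> test_map m N V k t (x i) = y"
    and nonneg: "\<And>i v. i \<in> {1..q} \<Longrightarrow> 0 \<le> x i $ v"
    and disj: "disjoint_family_on (\<lambda>i. vec_support (x i)) {1..q}"
    and lower: "(q - 1) * (n - m) + 1 \<le> (\<Sum>i\<in>{1..q}. card (vec_support (x i)))"
  defines "T \<equiv> \<lambda>i. vec_support (x i)"
  shows "almost_fair_splitting m V q T" "balanced_splitting q T"
proof -
  have upper: "card (T i \<inter> V j) < k j" if i: "i \<in> {1..q}" and j: "j \<in> {1..m}" for i j
    unfolding T_def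
  proof (rule card_vec_support_Int_less[OF _ disj _ nonneg _ i])
    show "card (V j) < card {1..q} * k j"
      using Suc_card_part[OF j] by simp
    show "elem_sym (V j) (k j) (($) (x i)) = y (j - 1)" if "i \<in> {1..q}" for i
      using y[OF that] test_map_elem_sym[OF j, of N V k t "x i"] by simp
  qed simp
  have "card (T i \<inter> V j) = k j - 1" if "i \<in> {1..q}" "j \<in> {1..m}" for i j
    using upper lower that unfolding T_def by (rule card_Int_part_eq)
  then show "almost_fair_splitting m V q T" "balanced_splitting q T"
    using disj unfolding T_def
    by (intro almost_fair_splitting_if_card_Int_eq balanced_splitting_if_card_Int_eq; blast)+
qed

lemma diff_le_card_vertices: "n - m \<le> CARD('v)"
proof -
  have "1 * n \<le> (q - 1) * n"
    using q_ge_2 by (intro mult_le_mono1) auto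
  then show ?thesis
    unfolding card_vertices by linarith
qed

lemma exists_splitting_of_coincidence:
  fixes e :: "nat \<Rightarrow> 'a::euclidean_space"
  assumes e: "inj_on e {..<n - m}" "e ` {..<n - m} \<subseteq> Basis"
    and t: "strong_general_position (span (e ` {..<n - m})) (\<lambda>v. moment_curve e (n - m) (t v)) UNIV"
    and S: "disjoint_family_on S {1..q}"
    and coincidence: "(\<Inter>i\<in>{1..q}. test_map m (n - 1) V k t ` realized_face (S i)) \<noteq> {}"
  obtains T where "\<forall>i\<in>{1..q}. T i \<subseteq> S i"
    and "almost_fair_splitting m V q T" "balanced_splitting q T"
proof -
  obtain y where "y \<in> (\<Inter>i\<in>{1..q}. test_map m (n - 1) V k t ` realized_face (S i))"
    using coincidence by blast
  then have "\<forall>i\<in>{1..q}. \<exists>x. x \<in> realized_face (S i) \<and> test_map m (n - 1) V k t x = y"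
    by blast
  then obtain x where x: "\<And>i. i \<in> {1..q} \<Longrightarrow> x i \<in> realized_face (S i)"
      and y: "\<And>i. i \<in> {1..q} \<Longrightarrow> test_map m (n - 1) V k t (x i) = y"
    by metis
  have support: "vec_support (x i) \<subseteq> S i" if "i \<in> {1..q}" for i
    using x[OF that] by (simp add: realized_face_eq)
  then have disj: "disjoint_family_on (\<lambda>i. vec_support (x i)) {1..q}"
    using S unfolding disjoint_family_on_def by blast
  have "moment t c (x i) = case_nat 1 (\<lambda>c. y (m + c)) c" if "i \<in> {1..q}" "c < n - m" for i c
    using that x[OF that(1)] y[OF that(1)] test_map_moment[of "c - 1" "n - 1" m V k t "x i"]
    by (cases c) (auto simp: moment_0 realized_face_eq)
  then have "(card {1..q} - 1) * (n - m) + 1 \<le> (\<Sum>i\<in>{1..q}. card (vec_support (x i)))"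
    using q_ge_2 m_less_n by (intro sum_card_vec_support_ge[OF e t _ _ disj, where c = 0]) auto
  then have lower: "(q - 1) * (n - m) + 1 \<le> (\<Sum>i\<in>{1..q}. card (vec_support (x i)))"
    by simp
  have nonneg: "0 \<le> x i $ v" if "i \<in> {1..q}" for i v
    using x[OF that] by (simp add: realized_face_eq)
  show ?thesis
  proof (rule that)
    show "\<forall>i\<in>{1..q}. vec_support (x i) \<subseteq> S i"
      using support by blast
  qed (use splitting_vec_support_if_test_map_eq[OF y nonneg disj lower] in simp_all)
qed

end

theorem theorem1p1:
  fixes E :: "'v::finite set set"
    and V :: "nat \<Rightarrow> 'v set"
    and k :: "nat \<Rightarrow> nat"
    and m n q :: nat
  assumes graph: "E \<subseteq> [UNIV]\<^bsup>2\<^esup>"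
    and partition_disjoint: "disjoint_family_on V {1..m}"
    and partition_cover: "(\<Union>j\<in>{1..m}. V j) = UNIV"
    and q: "q \<ge> 2"
    and n: "n \<ge> m + 1"
    and k: "\<forall>j\<in>{1..m}. k j \<ge> 1"
    and card_parts: "\<forall>j\<in>{1..m}. card (V j) = q * k j - 1"
    and card_vertices: "CARD('v) = (q - 1) * n + 1"
    and tverberg: "\<forall>F. continuous_map
            (top_of_set (geometric_realization (independence_complex E)))
            (Euclidean_space (n - 1)) F \<longrightarrow>
          (\<exists>S. (\<forall>i\<in>{1..q}. S i \<in> independence_complex E) \<and>
               disjoint_family_on S {1..q} \<and>
               (\<Inter>i\<in>{1..q}. F ` realized_face (S i)) \<noteq> {})"
  shows "\<exists>S. (\<forall>i\<in>{1..q}. indep (S i) E) \<and>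
             almost_fair_splitting m V q S \<and>
             balanced_splitting q S"
proof -
  interpret near_multiple_partition V k m n q
    by standard (use partition_disjoint partition_cover q n k card_parts card_vertices in simp_all)
  obtain e :: "nat \<Rightarrow> real ^ 'v" and t :: "'v \<Rightarrow> real"
    where e: "inj_on e {..<n - m}" "e ` {..<n - m} \<subseteq> Basis"
      and t: "strong_general_position (span (e ` {..<n - m})) (\<lambda>v. moment_curve e (n - m) (t v)) UNIV"
    using exists_generic_moment_curve[OF diff_le_card_vertices] .
  have "continuous_map (top_of_set (geometric_realization (independence_complex E)))
      (Euclidean_space (n - 1)) (test_map m (n - 1) V k t)"
    using n by (intro continuous_map_test_map) simp
  from tverberg[rule_format, OF this] obtain S
    where indep: "\<forall>i\<in>{1..q}. indep (S i) E" and disj: "disjoint_family_on S {1..q}"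
      and coincidence: "(\<Inter>i\<in>{1..q}. test_map m (n - 1) V k t ` realized_face (S i)) \<noteq> {}"
    unfolding independence_complex_def by blast
  obtain T where T: "\<forall>i\<in>{1..q}. T i \<subseteq> S i"
      and "almost_fair_splitting m V q T" "balanced_splitting q T"
    using exists_splitting_of_coincidence[OF e t disj coincidence] .
  moreover have "\<forall>i\<in>{1..q}. indep (T i) E"
    using indep T smaller_indep by blast
  ultimately show ?thesis by blast
qed

end
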